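(* Let $p$ be a prime, $\ell\ge1$, and let $f\in P_{p^\ell}$ be a nilpotent periodic sequence. If $e_\gamma$ is the leading component of its generating vector $\mathrm{vect}(f)$, then $\tau(\Sigma^sf)=\tau(\Sigma^{s+\gamma}[e_\gamma])$ for all sufficiently large $s$.
   Context: $P_{p^\ell}$ is the module of periodic sequences $\mathbb{N}\to\mathbb{Z}_{p^\ell}$, and $\tau$ denotes the (minimal) period. $\Delta f(n)=f(n+1)-f(n)$. A sequence $f$ is nilpotent if $\Delta^\eta f=0$ for some $\eta\ge1$; the minimal such $\eta$ is the nilpotency index. The generating vector is $\mathrm{vect}(f)=(e_0,\dots,e_{\eta-1})$ with $e_i=\Delta^if(0)$. The leading component is the last entry $e_\gamma$ of $\mathrm{vect}(f)$ having minimal $p$-adic valuation, where on $\mathbb{Z}_{p^\ell}$ the valuation of $0$ is $\infty$. $[c]$ is the constant sequence with value $c$. $\Sigma$ is the sum operator $\Sigma f(0)=0$, $\Sigma f(n)=f(n-1)+\Sigma f(n-1)$. *)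

theory Defs
  imports "HOL-Number_Theory.Residues" "HOL-Library.Extended_Nat"
begin

abbreviation Zpow :: "nat \<Rightarrow> nat \<Rightarrow> int ring" where
  "Zpow p l \<equiv> residue_ring (int (p ^ l))"

definition is_period :: "(nat \<Rightarrow> 'a) \<Rightarrow> nat \<Rightarrow> bool" where
  "is_period f T \<longleftrightarrow> T > 0 \<and> (\<forall>n. f (n + T) = f n)"

definition min_period :: "(nat \<Rightarrow> 'a) \<Rightarrow> nat" where
  "min_period f = (LEAST T. is_period f T)"

definition periodic_seqs :: "('a, 'b) ring_scheme \<Rightarrow> (nat \<Rightarrow> 'a) set" where
  "periodic_seqs R = {f. range f \<subseteq> carrier R \<and> (\<exists>T. is_period f T)}"

definition seq_diff :: "('a, 'b) ring_scheme \<Rightarrow> (nat \<Rightarrow> 'a) \<Rightarrow> nat \<Rightarrow> 'a" where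
  "seq_diff R f n = f (n + 1) \<ominus>\<^bsub>R\<^esub> f n"

primrec seq_sum :: "('a, 'b) ring_scheme \<Rightarrow> (nat \<Rightarrow> 'a) \<Rightarrow> nat \<Rightarrow> 'a" where
  "seq_sum R f 0 = \<zero>\<^bsub>R\<^esub>"
| "seq_sum R f (Suc n) = f n \<oplus>\<^bsub>R\<^esub> seq_sum R f n"

definition const_seq :: "'a \<Rightarrow> nat \<Rightarrow> 'a" where
  "const_seq c = (\<lambda>_. c)"

definition nilpotent_seq :: "('a, 'b) ring_scheme \<Rightarrow> (nat \<Rightarrow> 'a) \<Rightarrow> bool" where
  "nilpotent_seq R f \<longleftrightarrow> (\<exists>k\<ge>1. (seq_diff R ^^ k) f = const_seq \<zero>\<^bsub>R\<^esub>)"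

text \<open>The index is at least 1 even for the zero sequence, so generating vectors are nonempty.\<close>

definition nilpotency_index :: "('a, 'b) ring_scheme \<Rightarrow> (nat \<Rightarrow> 'a) \<Rightarrow> nat" where
  "nilpotency_index R f = (LEAST k. k \<ge> 1 \<and> (seq_diff R ^^ k) f = const_seq \<zero>\<^bsub>R\<^esub>)"

definition gen_vect :: "('a, 'b) ring_scheme \<Rightarrow> (nat \<Rightarrow> 'a) \<Rightarrow> 'a list" where
  "gen_vect R f = map (\<lambda>i. (seq_diff R ^^ i) f 0) [0..<nilpotency_index R f]"

text \<open>The valuation on the integers mod \<open>p ^ l\<close>, computed on the representative in
  \<open>{0..p ^ l - 1}\<close>; for nonzero residues it does not depend on the representative.\<close>

definition pval :: "nat \<Rightarrow> int \<Rightarrow> enat" where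
  "pval p x = (if x = 0 then \<infinity> else enat (multiplicity (int p) x))"

definition leading_index :: "nat \<Rightarrow> int list \<Rightarrow> nat" where
  "leading_index p v =
     Max {i. i < length v \<and> (\<forall>j < length v. pval p (v ! i) \<le> pval p (v ! j))}"

end

theory Submission
  imports Defs "HOL-Algebra.Exponent" "HOL-Library.More_List"
begin

text \<open>Newton's expansion gives \<open>\<Sigma>\<^sup>s f(n) = \<Sum>m. e\<^sub>m * (n choose (m + s))\<close> modulo \<open>p ^ l\<close>. If \<open>e\<^sub>\<gamma> = 0\<close>,
  both sequences vanish. Otherwise let \<open>v\<close> be the valuation of \<open>e\<^sub>\<gamma>\<close> and \<open>p ^ L \<le> s + \<gamma> < p ^ (L + 1)\<close>.
  As soon as \<open>e\<^sub>m = 0\<close> for all \<open>m \<ge> p ^ L\<close>, the minimal period is \<open>p ^ (l - v + L)\<close>, a number that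
  depends on \<open>e\<close> only through \<open>v\<close> and \<open>\<gamma>\<close>; the sequence \<open>\<Sigma>\<^sup>s\<^sup>+\<^sup>\<gamma> [e\<^sub>\<gamma>]\<close> has the same two parameters.
  Since \<open>p ^ T choose j\<close> has valuation \<open>T - v\<^sub>p j\<close> for \<open>1 \<le> j \<le> p ^ T\<close>, Vandermonde's identity
  shows that \<open>p ^ (l - v + L)\<close> is a period: components after \<open>e\<^sub>\<gamma>\<close> may gain one in \<open>v\<^sub>p j\<close> but have
  valuation larger than \<open>v\<close>. To exclude the period \<open>p ^ (l - v + L - 1)\<close>, take differences until
  the leading component multiplies \<open>n choose p ^ L\<close>; at \<open>n = p ^ (l - v + L - 1)\<close> it is then the
  only term that does not vanish modulo \<open>p ^ l\<close>.\<close>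

subsection \<open>Periods\<close>

lemma is_period_mult:
  assumes "is_period f T" "k > 0"
  shows "is_period f (k * T)"
proof -
  have "f (n + k * T) = f n" for n k
  proof (induction k)
    case (Suc k)
    have "f (n + Suc k * T) = f ((n + k * T) + T)" by (simp add: algebra_simps)
    then show ?case using assms Suc by (simp add: is_period_def)
  qed simp
  then show ?thesis using assms by (simp add: is_period_def)
qed

lemma is_period_min_period: "is_period f T \<Longrightarrow> is_period f (min_period f)"
  unfolding min_period_def by (rule LeastI)

lemma min_period_le: "is_period f T \<Longrightarrow> min_period f \<le> T"
  unfolding min_period_def by (rule Least_le)

lemma is_period_mod:
  assumes "is_period f T" "is_period f d" "\<not> d dvd T"
  shows "is_period f (T mod d)"
proof -
  have "f (n + T mod d) = f n" for n
  proof -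
    have "f (k + (T div d) * d) = f k" for k
      using is_period_mult[OF assms(2), of "T div d"]
      by (cases "T div d = 0") (simp_all add: is_period_def)
    then have "f (n + T mod d) = f (n + T mod d + (T div d) * d)" by (rule sym)
    also have "\<dots> = f (n + T)" by (simp add: add.assoc)
    also have "\<dots> = f n" using assms(1) by (simp add: is_period_def)
    finally show ?thesis .
  qed
  then show ?thesis using assms(3) by (auto simp: is_period_def dvd_eq_mod_eq_0)
qed

lemma is_period_iff_min_period_dvd:
  assumes "is_period f T"
  shows "is_period f S \<longleftrightarrow> S > 0 \<and> min_period f dvd S"
proof
  have min_period: "is_period f (min_period f)" using assms by (rule is_period_min_period)
  show "S > 0 \<and> min_period f dvd S" if S: "is_period f S"
  proof
    show "S > 0" using S by (simp add: is_period_def)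
    show "min_period f dvd S"
    proof (rule ccontr)
      assume "\<not> min_period f dvd S"
      then have "min_period f \<le> S mod min_period f"
        by (intro min_period_le is_period_mod S min_period)
      moreover have "S mod min_period f < min_period f"
        using min_period by (simp add: is_period_def)
      ultimately show False by simp
    qed
  qed
  show "is_period f S" if S: "S > 0 \<and> min_period f dvd S"
  proof -
    obtain k where "S = k * min_period f" using S by (metis dvdE mult.commute)
    then show ?thesis using is_period_mult[OF min_period] S by simp
  qed
qed

lemma min_period_eq_prime_power:
  assumes "prime p" "is_period f (p ^ Suc k)" "\<not> is_period f (p ^ k)"
  shows "min_period f = p ^ Suc k"
proof -
  have "min_period f dvd p ^ Suc k" "\<not> min_period f dvd p ^ k"
    using assms prime_gt_0_nat by (simp_all add: is_period_iff_min_period_dvd[OF assms(2)])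
  then obtain i where "min_period f = p ^ i" "i \<le> Suc k" "\<not> i \<le> k"
    using divides_primepow_nat[OF assms(1)] by (meson le_imp_power_dvd)
  then show ?thesis by (simp add: le_Suc_eq)
qed

lemma is_period_mod_iff:
  fixes g :: "nat \<Rightarrow> 'a::euclidean_ring_cancel"
  shows "is_period (\<lambda>n. g n mod q) T \<longleftrightarrow> T > 0 \<and> (\<forall>n. q dvd g (n + T) - g n)"
  by (simp add: is_period_def mod_eq_dvd_iff)

subsection \<open>Binomial coefficients\<close>

lemma prime_power_dvd_prime_power_choose:
  fixes p :: nat
  assumes "prime p" "\<not> p ^ r dvd j" "k + r = Suc T"
  shows "p ^ k dvd p ^ T choose j"
proof -
  have "j > 0" using assms(2) by (cases j) auto
  then have "j * (p ^ T choose j) = p ^ T * ((p ^ T - 1) choose (j - 1))"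
    by (rule times_binomial_minus1_eq)
  then have "p ^ T dvd j * (p ^ T choose j)" by simp
  then show ?thesis
    using prime_elem_power_dvd_cases[of p T j "p ^ T choose j" r k] assms by auto
qed

lemma prime_power_Suc_not_dvd_prime_power_choose:
  fixes p :: nat
  assumes "prime p"
  shows "\<not> p ^ Suc k dvd p ^ (k + r) choose p ^ r"
proof -
  have "p > 0" using assms by (rule prime_gt_0_nat)
  then have "multiplicity p (p ^ r * p ^ k choose p ^ r) = k"
    using const_p_fac[of "p ^ k" p r] assms by simp
  moreover have "p ^ (k + r) choose p ^ r > 0"
    using \<open>p > 0\<close> by (simp add: power_increasing)
  ultimately show ?thesis
    using assms multiplicity_geI[of "p ^ (k + r) choose p ^ r" p "Suc k"]
    by (auto simp: power_add mult.commute prime_nat_iff)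
qed

lemma binomial_add_eq:
  "(n + T) choose k = (n choose k) + (\<Sum>j=1..k. (T choose j) * (n choose (k - j)))"
proof -
  have "(n + T) choose k = (\<Sum>j\<le>k. (T choose j) * (n choose (k - j)))"
    by (subst add.commute) (rule vandermonde[symmetric])
  also have "{..k} = insert 0 {1..k}" by auto
  also have "(\<Sum>j\<in>\<dots>. (T choose j) * (n choose (k - j)))
      = (n choose k) + (\<Sum>j=1..k. (T choose j) * (n choose (k - j)))"
    by (subst sum.insert) auto
  finally show ?thesis .
qed

lemma power_add_dvd_mult_of_nat:
  "int p ^ a dvd x \<Longrightarrow> p ^ b dvd c \<Longrightarrow> int p ^ (a + b) dvd x * int c"
  by (simp add: power_add mult_dvd_mono flip: of_nat_power)

lemma not_dvd_if_less_double:
  fixes q x :: nat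
  assumes "x < 2 * q" "x > 0" "x \<noteq> q"
  shows "\<not> q dvd x"
proof
  assume "q dvd x"
  then obtain c where "x = q * c" ..
  then have "c < 2" "c > 0" "c \<noteq> 1" using assms by auto
  then show False by simp
qed

subsection \<open>Newton series\<close>

text \<open>The terms with \<open>m > n\<close> of the full series vanish.\<close>

definition newton_series :: "(nat \<Rightarrow> 'a::comm_ring_1) \<Rightarrow> nat \<Rightarrow> nat \<Rightarrow> 'a" where
  "newton_series e s n = (\<Sum>m\<le>n. e m * of_nat (n choose (m + s)))"

lemma newton_series_eq_sum:
  assumes "n \<le> N"
  shows "newton_series e s n = (\<Sum>m\<le>N. e m * of_nat (n choose (m + s)))"
  unfolding newton_series_def using assms
  by (intro sum.mono_neutral_left) (auto simp: binomial_eq_0)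

lemma newton_series_at_0: "newton_series e s 0 = (if s = 0 then e 0 else 0)"
  by (simp add: newton_series_def binomial_eq_0)

lemma newton_series_Suc:
  "newton_series e (Suc s) (Suc n) = newton_series e s n + newton_series e (Suc s) n"
  by (simp add: newton_series_eq_sum[of _ "Suc n"] distrib_left sum.distrib del: sum.atMost_Suc)

lemma newton_series_0_Suc:
  "newton_series e 0 (Suc n) = newton_series e 0 n + newton_series (\<lambda>i. e (Suc i)) 0 n"
proof -
  have "newton_series e 0 (Suc n)
      = e 0 + (\<Sum>m\<le>n. e (Suc m) * of_nat ((n choose m) + (n choose Suc m)))"
    unfolding newton_series_def sum.atMost_Suc_shift by simp
  also have "\<dots> = (e 0 + (\<Sum>m\<le>n. e (Suc m) * of_nat (n choose Suc m)))
      + newton_series (\<lambda>i. e (Suc i)) 0 n"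
    by (simp add: newton_series_def distrib_left sum.distrib)
  also have "e 0 + (\<Sum>m\<le>n. e (Suc m) * of_nat (n choose Suc m)) = newton_series e 0 n"
    unfolding newton_series_eq_sum[OF le_SucI[OF le_refl]] sum.atMost_Suc_shift by simp
  finally show ?thesis .
qed

lemma newton_series_single:
  "newton_series ((\<lambda>_. 0)(i := c)) s n = c * of_nat (n choose (i + s))"
  by (simp add: newton_series_def fun_upd_def if_distribR binomial_eq_0
      if_distrib[of "\<lambda>x. x * _"] cong: if_cong)

lemma is_period_newton_series_addD:
  fixes e :: "nat \<Rightarrow> 'a::euclidean_ring_cancel"
  assumes "is_period (\<lambda>n. newton_series e (r + d) n mod q) T"
  shows "is_period (\<lambda>n. newton_series e r n mod q) T"
  using assms
proof (induction d)
  case (Suc d)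
  let ?g = "newton_series e (Suc (r + d))"
  have period: "T > 0" "\<And>n. q dvd ?g (n + T) - ?g n"
    using Suc.prems by (auto simp: is_period_mod_iff)
  have "q dvd newton_series e (r + d) (n + T) - newton_series e (r + d) n" for n
    using dvd_diff[OF period(2)[of "Suc n"] period(2)[of n]]
    by (simp add: newton_series_Suc algebra_simps)
  then show ?case using period(1) Suc.IH by (simp add: is_period_mod_iff)
qed simp

lemma is_period_newton_series:
  fixes e :: "nat \<Rightarrow> 'a::euclidean_ring_cancel"
  assumes "T > 0"
    and dvd: "\<And>m j. 1 \<le> j \<Longrightarrow> j \<le> m + s \<Longrightarrow> q dvd e m * of_nat (T choose j)"
  shows "is_period (\<lambda>n. newton_series e s n mod q) T"
proof -
  have "q dvd newton_series e s (n + T) - newton_series e s n" for n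
  proof -
    have "newton_series e s (n + T) - newton_series e s n
        = (\<Sum>m\<le>n + T. e m * (of_nat ((n + T) choose (m + s)) - of_nat (n choose (m + s))))"
      by (simp add: newton_series_eq_sum[of _ "n + T"] right_diff_distrib sum_subtractf)
    also have "\<dots> = (\<Sum>m\<le>n + T. \<Sum>j=1..m + s.
        (e m * of_nat (T choose j)) * of_nat (n choose (m + s - j)))"
      by (simp add: binomial_add_eq sum_distrib_left mult.assoc)
    also have "q dvd \<dots>" by (intro dvd_sum dvd_mult2 dvd) auto
    finally show ?thesis .
  qed
  then show ?thesis using assms(1) by (simp add: is_period_mod_iff)
qed

subsection \<open>Leading components\<close>

definition has_leading_component :: "nat \<Rightarrow> (nat \<Rightarrow> int) \<Rightarrow> nat \<Rightarrow> nat \<Rightarrow> bool" where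
  "has_leading_component p e \<gamma> v \<longleftrightarrow>
     (\<forall>m. int p ^ v dvd e m) \<and> (\<forall>m>\<gamma>. int p ^ Suc v dvd e m) \<and> \<not> int p ^ Suc v dvd e \<gamma>"

lemma is_period_newton_series_prime_power:
  assumes p: "prime p" and lead: "has_leading_component p e \<gamma> v"
    and vanish: "\<And>m. p ^ L \<le> m \<Longrightarrow> int p ^ (Suc v + k) dvd e m"
    and upper: "s + \<gamma> < p ^ Suc L"
  shows "is_period (\<lambda>n. newton_series e s n mod int p ^ (Suc v + k)) (p ^ Suc (k + L))"
proof (rule is_period_newton_series)
  show "p ^ Suc (k + L) > 0" using p by (simp add: prime_gt_0_nat)
next
  fix m j assume j: "1 \<le> j" "j \<le> m + s"
  consider (up_to_leading) "m \<le> \<gamma>" | (after_leading) "\<gamma> < m" "m < p ^ L" | (vanishing) "p ^ L \<le> m"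
    by linarith
  then show "int p ^ (Suc v + k) dvd e m * int (p ^ Suc (k + L) choose j)"
  proof cases
    case up_to_leading
    then have "\<not> p ^ Suc L dvd j" using j upper by (auto dest!: dvd_imp_le)
    then have "p ^ Suc k dvd p ^ Suc (k + L) choose j"
      by (rule prime_power_dvd_prime_power_choose[OF p]) simp
    then have "int p ^ (v + Suc k) dvd e m * int (p ^ Suc (k + L) choose j)"
      using lead by (intro power_add_dvd_mult_of_nat) (simp_all add: has_leading_component_def)
    then show ?thesis by simp
  next
    case after_leading
    have "j < p ^ L + p ^ Suc L" using j after_leading upper by linarith
    also have "\<dots> \<le> 2 * p ^ Suc L" using prime_gt_0_nat[OF p] by simp
    also have "\<dots> \<le> p * p ^ Suc L" using prime_ge_2_nat[OF p] by (rule mult_le_mono1)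
    finally have "\<not> p ^ Suc (Suc L) dvd j" using j by (auto dest!: dvd_imp_le)
    then have "p ^ k dvd p ^ Suc (k + L) choose j"
      by (rule prime_power_dvd_prime_power_choose[OF p]) simp
    then show ?thesis
      using lead after_leading(1)
      by (intro power_add_dvd_mult_of_nat) (simp_all add: has_leading_component_def)
  next
    case vanishing
    then show ?thesis by (intro dvd_mult2 vanish)
  qed
qed

lemma nonleading_term_dvd:
  assumes p: "prime p" and lead: "has_leading_component p e \<gamma> v"
    and vanish: "\<And>m. p ^ L \<le> m \<Longrightarrow> int p ^ (Suc v + k) dvd e m"
    and r: "\<gamma> + r = p ^ L" "r > 0" and "m \<noteq> \<gamma>"
  shows "int p ^ (Suc v + k) dvd e m * int (p ^ (k + L) choose (m + r))"
proof (cases "p ^ L \<le> m")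
  case True
  then show ?thesis by (intro dvd_mult2 vanish)
next
  case False
  then have "\<not> p ^ L dvd m + r" using \<open>m \<noteq> \<gamma>\<close> r by (intro not_dvd_if_less_double) auto
  then have "p ^ Suc k dvd p ^ (k + L) choose (m + r)"
    by (rule prime_power_dvd_prime_power_choose[OF p]) simp
  then have "int p ^ (v + Suc k) dvd e m * int (p ^ (k + L) choose (m + r))"
    using lead by (intro power_add_dvd_mult_of_nat) (simp_all add: has_leading_component_def)
  then show ?thesis by simp
qed

lemma newton_series_at_prime_power_not_dvd:
  assumes p: "prime p" and lead: "has_leading_component p e \<gamma> v"
    and vanish: "\<And>m. p ^ L \<le> m \<Longrightarrow> int p ^ (Suc v + k) dvd e m"
    and r: "\<gamma> + r = p ^ L" "r > 0"
  shows "\<not> int p ^ (Suc v + k) dvd newton_series e r (p ^ (k + L))"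
proof
  let ?q = "int p ^ (Suc v + k)" and ?C = "\<lambda>m. p ^ (k + L) choose (m + r)"
  assume "?q dvd newton_series e r (p ^ (k + L))"
  moreover have "newton_series e r (p ^ (k + L))
      = e \<gamma> * int (?C \<gamma>) + (\<Sum>m\<in>{..p ^ (k + L)} - {\<gamma>}. e m * int (?C m))"
  proof -
    have "p ^ L \<le> p ^ (k + L)" using prime_gt_0_nat[OF p] by (simp add: power_increasing)
    then have "\<gamma> \<le> p ^ (k + L)" using r(1) by linarith
    then show ?thesis unfolding newton_series_def by (subst sum.remove[of _ \<gamma>]) auto
  qed
  moreover have "?q dvd (\<Sum>m\<in>{..p ^ (k + L)} - {\<gamma>}. e m * int (?C m))"
    by (intro dvd_sum nonleading_term_dvd[OF p lead vanish r]) auto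
  ultimately have "?q dvd e \<gamma> * int (?C \<gamma>)" by (simp add: dvd_add_left_iff)
  then have "int p ^ Suc v dvd e \<gamma> \<or> int p ^ Suc k dvd int (?C \<gamma>)"
    using p by (intro prime_elem_power_dvd_cases[of _ "Suc v + k"]) auto
  moreover have "\<not> int p ^ Suc k dvd int (?C \<gamma>)"
    using prime_power_Suc_not_dvd_prime_power_choose[OF p, of k L] r(1)
    by (simp only: of_nat_dvd_iff flip: of_nat_power) simp
  ultimately show False using lead by (simp add: has_leading_component_def)
qed

lemma min_period_newton_series:
  assumes p: "prime p" and lead: "has_leading_component p e \<gamma> v"
    and vanish: "\<And>m. p ^ L \<le> m \<Longrightarrow> int p ^ (Suc v + k) dvd e m"
    and window: "p ^ L \<le> s + \<gamma>" "s + \<gamma> < p ^ Suc L"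
  shows "min_period (\<lambda>n. newton_series e s n mod int p ^ (Suc v + k)) = p ^ Suc (k + L)"
proof (rule min_period_eq_prime_power[OF p])
  let ?q = "int p ^ (Suc v + k)"
  show "is_period (\<lambda>n. newton_series e s n mod ?q) (p ^ Suc (k + L))"
    using p lead vanish window(2) by (rule is_period_newton_series_prime_power)
  show "\<not> is_period (\<lambda>n. newton_series e s n mod ?q) (p ^ (k + L))"
  proof
    have "\<not> ?q dvd e \<gamma>"
      using lead unfolding has_leading_component_def by (metis power_le_dvd le_add1)
    then have "\<gamma> < p ^ L" using vanish by (meson not_less)
    define r where "r = p ^ L - \<gamma>"
    have r: "\<gamma> + r = p ^ L" "r > 0" "s = r + (s - r)"
      using \<open>\<gamma> < p ^ L\<close> window(1) by (auto simp: r_def)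
    assume "is_period (\<lambda>n. newton_series e s n mod ?q) (p ^ (k + L))"
    then have "is_period (\<lambda>n. newton_series e r n mod ?q) (p ^ (k + L))"
      by (subst (asm) r(3)) (rule is_period_newton_series_addD)
    then have "?q dvd newton_series e r (0 + p ^ (k + L)) - newton_series e r 0"
      unfolding is_period_mod_iff by blast
    then show False
      using newton_series_at_prime_power_not_dvd[OF p lead vanish r(1,2)] r(2)
      by (simp add: newton_series_at_0)
  qed
qed

lemma eventually_min_period_newton_series:
  assumes p: "prime p" and lead: "has_leading_component p e \<gamma> v" and "v < l"
    and zero: "\<And>m. N \<le> m \<Longrightarrow> e m = 0"
  shows "\<forall>\<^sub>F s in sequentially. min_period (\<lambda>n. newton_series e s n mod int p ^ l) =
           min_period (\<lambda>n. e \<gamma> * int (n choose (s + \<gamma>)) mod int p ^ l)"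
proof (rule eventually_sequentiallyI)
  fix s assume s: "p ^ N \<le> s"
  let ?single = "(\<lambda>_. 0)(\<gamma> := e \<gamma>)"
  have "p \<ge> 2" using p by (rule prime_ge_2_nat)
  obtain k where l: "l = Suc v + k" using \<open>v < l\<close> by (auto dest: less_imp_Suc_add)
  have "p ^ N > 0" using \<open>p \<ge> 2\<close> by simp
  then have "s + \<gamma> \<ge> 1" using s by linarith
  then obtain L where L: "p ^ L \<le> s + \<gamma>" "s + \<gamma> < p ^ Suc L"
    using ex_power_ivl1[OF \<open>p \<ge> 2\<close>] by (metis Suc_eq_plus1)
  have "p ^ N < p ^ Suc L" using s L(2) by linarith
  then have "N \<le> L" using \<open>p \<ge> 2\<close> by (simp add: del: power_Suc)
  also have "L < 2 ^ L" by (rule less_exp)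
  also have "2 ^ L \<le> p ^ L" using \<open>p \<ge> 2\<close> by (intro power_mono) simp_all
  finally have vanish: "e m = 0" if "p ^ L \<le> m" for m using zero that by simp
  have "min_period (\<lambda>n. newton_series e s n mod int p ^ l) = p ^ Suc (k + L)"
    unfolding l using p lead _ L by (rule min_period_newton_series) (simp add: vanish)
  moreover have "min_period (\<lambda>n. newton_series ?single s n mod int p ^ l) = p ^ Suc (k + L)"
    unfolding l using p _ _ L
  proof (rule min_period_newton_series)
    show "has_leading_component p ?single \<gamma> v"
      using lead by (auto simp: has_leading_component_def)
  qed (simp add: vanish)
  ultimately show "min_period (\<lambda>n. newton_series e s n mod int p ^ l) =
      min_period (\<lambda>n. e \<gamma> * int (n choose (s + \<gamma>)) mod int p ^ l)"
    by (simp add: newton_series_single add.commute)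
qed

lemma
  assumes "xs \<noteq> []"
  shows leading_index_less_length: "leading_index p xs < length xs"
    and pval_leading_index_le:
      "j < length xs \<Longrightarrow> pval p (xs ! leading_index p xs) \<le> pval p (xs ! j)"
proof -
  let ?M = "{i. i < length xs \<and> (\<forall>j < length xs. pval p (xs ! i) \<le> pval p (xs ! j))}"
  have "arg_min_on (\<lambda>i. pval p (xs ! i)) {..<length xs} \<in> ?M"
    using assms arg_min_if_finite(1)[of "{..<length xs}" "\<lambda>i. pval p (xs ! i)"]
      arg_min_least[of "{..<length xs}" _ "\<lambda>i. pval p (xs ! i)"] by fastforce
  then have "leading_index p xs \<in> ?M"
    unfolding leading_index_def by (intro Max_in) auto
  then show "leading_index p xs < length xs"
    and "j < length xs \<Longrightarrow> pval p (xs ! leading_index p xs) \<le> pval p (xs ! j)" by auto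
qed

lemma pval_leading_index_less:
  assumes "leading_index p xs < j" "j < length xs"
  shows "pval p (xs ! leading_index p xs) < pval p (xs ! j)"
proof (rule ccontr)
  assume "\<not> ?thesis"
  moreover have "xs \<noteq> []" using assms(2) by auto
  ultimately have "\<forall>i < length xs. pval p (xs ! j) \<le> pval p (xs ! i)"
    using pval_leading_index_le by (meson not_less order_trans)
  then have "j \<le> leading_index p xs"
    unfolding leading_index_def using assms(2) by (intro Max_ge) auto
  then show False using assms(1) by simp
qed

lemma enat_le_pval_iff:
  assumes "prime p"
  shows "enat k \<le> pval p x \<longleftrightarrow> int p ^ k dvd x"
proof (cases "x = 0")
  case False
  have "\<not> is_unit (int p)" using assms by (auto simp: prime_nat_iff)
  with False show ?thesis
    by (auto simp: pval_def intro: multiplicity_dvd' multiplicity_geI)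
qed (simp add: pval_def)

lemma has_leading_component_leading_index:
  assumes p: "prime p" and "xs \<noteq> []" and "xs ! leading_index p xs \<noteq> 0"
  shows "has_leading_component p (nth_default 0 xs) (leading_index p xs)
           (multiplicity (int p) (xs ! leading_index p xs))"
proof -
  let ?v = "multiplicity (int p) (xs ! leading_index p xs)"
  have v: "pval p (xs ! leading_index p xs) = enat ?v" using assms(3) by (simp add: pval_def)
  have "int p ^ ?v dvd nth_default 0 xs m" for m
    using pval_leading_index_le[OF assms(2), of m p]
    by (simp add: nth_default_def v enat_le_pval_iff[OF p])
  moreover have "int p ^ Suc ?v dvd nth_default 0 xs m" if "leading_index p xs < m" for m
    using pval_leading_index_less[OF that] pval_def[of p 0]
    by (simp add: nth_default_def v Suc_ile_eq del: power_Suc flip: enat_le_pval_iff[OF p])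
  moreover have "\<not> int p ^ Suc ?v dvd nth_default 0 xs (leading_index p xs)"
    using leading_index_less_length[OF assms(2), of p]
    by (simp add: nth_default_nth v del: power_Suc flip: enat_le_pval_iff[OF p])
  ultimately show ?thesis unfolding has_leading_component_def by blast
qed

lemma eventually_min_period_leading_index:
  assumes p: "prime p" and "xs \<noteq> []" and range: "set xs \<subseteq> {0..<int p ^ l}"
    and \<gamma>: "\<gamma> = leading_index p xs"
  shows "\<forall>\<^sub>F s in sequentially.
           min_period (\<lambda>n. newton_series (nth_default 0 xs) s n mod int p ^ l) =
           min_period (\<lambda>n. xs ! \<gamma> * int (n choose (s + \<gamma>)) mod int p ^ l)"
proof (cases "xs ! \<gamma> = 0")
  case True
  then have "xs ! j = 0" if "j < length xs" for j
    using pval_leading_index_le[OF assms(2) that, of p] \<gamma> by (simp add: pval_def split: if_splits)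
  then have "nth_default 0 xs = (\<lambda>_. 0)" by (auto simp: nth_default_def)
  then show ?thesis using True by (simp add: newton_series_def)
next
  case False
  have \<gamma>_less: "\<gamma> < length xs" using leading_index_less_length[OF assms(2)] \<gamma> by simp
  then have "xs ! \<gamma> \<in> {0..<int p ^ l}" using range nth_mem by blast
  then have "\<not> int p ^ l dvd xs ! \<gamma>" using False by (auto dest: zdvd_imp_le)
  then have "multiplicity (int p) (xs ! \<gamma>) < l" using multiplicity_dvd' not_less by blast
  moreover have "has_leading_component p (nth_default 0 xs) \<gamma> (multiplicity (int p) (xs ! \<gamma>))"
    using has_leading_component_leading_index[OF p assms(2)] False \<gamma> by simp
  ultimately show ?thesis
    using eventually_min_period_newton_series[OF p, of "nth_default 0 xs" \<gamma> _ l "length xs"] \<gamma>_less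
    by (simp add: nth_default_nth nth_default_beyond)
qed

subsection \<open>Generating vectors\<close>

lemma
  assumes "nilpotent_seq R f"
  shows nilpotency_index_ge_1: "nilpotency_index R f \<ge> 1"
    and seq_diff_funpow_nilpotency_index:
      "(seq_diff R ^^ nilpotency_index R f) f = const_seq \<zero>\<^bsub>R\<^esub>"
  using assms LeastI_ex[of "\<lambda>k. k \<ge> 1 \<and> (seq_diff R ^^ k) f = const_seq \<zero>\<^bsub>R\<^esub>"]
  by (auto simp: nilpotent_seq_def nilpotency_index_def)

lemma (in abelian_group) seq_diff_funpow_closed:
  assumes "range f \<subseteq> carrier G"
  shows "(seq_diff G ^^ i) f n \<in> carrier G"
  using assms by (induction i arbitrary: n) (auto simp: seq_diff_def)

lemma (in abelian_group) seq_diff_funpow_eq_zero: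
  assumes "nilpotent_seq G f" "nilpotency_index G f \<le> i"
  shows "(seq_diff G ^^ i) f = const_seq \<zero>"
  using assms(2)
proof (induction i rule: dec_induct)
  case base
  show ?case using assms(1) by (rule seq_diff_funpow_nilpotency_index)
next
  case (step i)
  then show ?case by (simp add: seq_diff_def const_seq_def fun_eq_iff a_minus_def r_neg)
qed

lemma (in abelian_group) set_gen_vect_subset:
  "range f \<subseteq> carrier G \<Longrightarrow> set (gen_vect G f) \<subseteq> carrier G"
  by (auto simp: gen_vect_def seq_diff_funpow_closed)

lemma gen_vect_nonempty: "nilpotent_seq R f \<Longrightarrow> gen_vect R f \<noteq> []"
  using nilpotency_index_ge_1[of R f] by (simp add: gen_vect_def)

lemma (in abelian_group) nth_default_gen_vect:
  assumes "nilpotent_seq G f"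
  shows "nth_default \<zero> (gen_vect G f) i = (seq_diff G ^^ i) f 0"
  using seq_diff_funpow_eq_zero[OF assms, of i]
  by (simp add: gen_vect_def nth_default_def const_seq_def)

subsection \<open>Iterated sums over residue rings\<close>

context residues
begin

lemma carrier_mod_eq: "x \<in> carrier R \<Longrightarrow> x mod m = x"
  by (simp add: res_carrier_eq)

lemma res_seq_diff_eq: "seq_diff R f n = (f (n + 1) - f n) mod m"
  by (simp add: seq_diff_def a_minus_def res_neg_eq res_add_eq mod_simps)

lemma newton_expansion:
  assumes "range f \<subseteq> carrier R"
  shows "f n = newton_series (\<lambda>i. (seq_diff R ^^ i) f 0) 0 n mod m"
  using assms
proof (induction n arbitrary: f)
  case 0
  then have "f 0 mod m = f 0" by (intro carrier_mod_eq) auto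
  then show ?case by (simp add: newton_series_at_0)
next
  case (Suc n)
  let ?e = "\<lambda>i. (seq_diff R ^^ i) f 0"
  have "range (seq_diff R f) \<subseteq> carrier R" using seq_diff_funpow_closed[OF Suc.prems, of 1] by auto
  then have "seq_diff R f n = newton_series (\<lambda>i. (seq_diff R ^^ i) (seq_diff R f) 0) 0 n mod m"
    by (rule Suc.IH)
  then have diff: "seq_diff R f n = newton_series (\<lambda>i. ?e (Suc i)) 0 n mod m"
    by (simp add: funpow_swap1)
  have "f (Suc n) = f (Suc n) mod m" using Suc.prems by (intro carrier_mod_eq[symmetric]) auto
  also have "\<dots> = (f n + seq_diff R f n) mod m" by (simp add: res_seq_diff_eq mod_simps)
  also have "\<dots> = (newton_series ?e 0 n + newton_series (\<lambda>i. ?e (Suc i)) 0 n) mod m"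
    by (subst diff, subst Suc.IH[OF Suc.prems]) (simp add: mod_simps)
  also have "\<dots> = newton_series ?e 0 (Suc n) mod m" by (simp only: newton_series_0_Suc)
  finally show ?case .
qed

lemma seq_sum_newton_series:
  "seq_sum R (\<lambda>n. newton_series e s n mod m) = (\<lambda>n. newton_series e (Suc s) n mod m)"
proof
  show "seq_sum R (\<lambda>n. newton_series e s n mod m) n = newton_series e (Suc s) n mod m" for n
    by (induction n)
      (simp_all add: newton_series_at_0 newton_series_Suc res_zero_eq res_add_eq mod_simps)
qed

lemma seq_sum_funpow_newton_series:
  "(seq_sum R ^^ s) (\<lambda>n. newton_series e 0 n mod m) = (\<lambda>n. newton_series e s n mod m)"
  by (induction s) (simp_all add: seq_sum_newton_series)

lemma seq_sum_funpow_gen_vect: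
  assumes "range f \<subseteq> carrier R" "nilpotent_seq R f"
  shows "(seq_sum R ^^ s) f = (\<lambda>n. newton_series (nth_default 0 (gen_vect R f)) s n mod m)"
proof -
  have "nth_default 0 (gen_vect R f) = (\<lambda>i. (seq_diff R ^^ i) f 0)"
    using nth_default_gen_vect[OF assms(2)] by (auto simp: res_zero_eq)
  then have "f = (\<lambda>n. newton_series (nth_default 0 (gen_vect R f)) 0 n mod m)"
    using newton_expansion[OF assms(1)] by auto
  then show ?thesis by (metis seq_sum_funpow_newton_series)
qed

lemma seq_sum_funpow_const_seq:
  assumes "c \<in> carrier R"
  shows "(seq_sum R ^^ s) (const_seq c) = (\<lambda>n. c * int (n choose s) mod m)"
proof -
  have "(seq_sum R ^^ s) (const_seq c)
      = (seq_sum R ^^ s) (\<lambda>n. newton_series ((\<lambda>_. 0)(0 := c)) 0 n mod m)"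
    using assms by (simp add: newton_series_single const_seq_def carrier_mod_eq)
  also have "\<dots> = (\<lambda>n. newton_series ((\<lambda>_. 0)(0 := c)) s n mod m)"
    by (rule seq_sum_funpow_newton_series)
  finally show ?thesis by (simp add: newton_series_single)
qed

end

theorem theorem3p5:
  fixes p l \<gamma> :: nat and f :: "nat \<Rightarrow> int"
  assumes "prime p" and "l \<ge> 1"
    and "f \<in> periodic_seqs (Zpow p l)"
    and "nilpotent_seq (Zpow p l) f"
    and "\<gamma> = leading_index p (gen_vect (Zpow p l) f)"
  shows "\<forall>\<^sub>F s in sequentially.
           min_period ((seq_sum (Zpow p l) ^^ s) f) =
           min_period ((seq_sum (Zpow p l) ^^ (s + \<gamma>)) (const_seq (gen_vect (Zpow p l) f ! \<gamma>)))"
proof -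
  let ?R = "Zpow p l"
  let ?e = "gen_vect ?R f"
  have "1 < p ^ l" using prime_ge_2_nat[OF assms(1)] assms(2) by (intro one_less_power) auto
  then interpret residues "int (p ^ l)" ?R
    by unfold_locales (simp_all del: of_nat_power)
  have range: "range f \<subseteq> carrier ?R" using assms(3) by (simp add: periodic_seqs_def)
  have nonempty: "?e \<noteq> []" using assms(4) by (rule gen_vect_nonempty)
  have components: "set ?e \<subseteq> {0..<int p ^ l}"
    using set_gen_vect_subset[OF range] unfolding res_carrier_eq by auto
  have "\<gamma> < length ?e" using leading_index_less_length[OF nonempty] assms(5) by simp
  then have lead: "?e ! \<gamma> \<in> carrier ?R" using set_gen_vect_subset[OF range] nth_mem by blast
  show ?thesis
    unfolding seq_sum_funpow_gen_vect[OF range assms(4)] seq_sum_funpow_const_seq[OF lead]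
    using eventually_min_period_leading_index[OF assms(1) nonempty components assms(5)] by simp
qed

end
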